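(* Let $(D_\lambda)_{\lambda\in\Lambda}$ be a family of commutative rings, let $R=\prod_{\lambda\in\Lambda}D_\lambda$, and let $T\subseteq R$ be a subring. The following assertions are equivalent: (a) $T$ has the Skolem-property. (b) For every proper ideal $\mathfrak{A}\subseteq T$, the set $\{S(a)\mid a\in\mathfrak{A}\}\subseteq\mathcal{B}$ satisfies the finite intersection property. (c) Every proper ideal of $T$ is contained in an ideal of the form $(\mathcal{U})_T$, where $\mathcal{U}$ is an ultrafilter in $\mathcal{B}$. (d) Every maximal ideal of $T$ is of the form $(\mathcal{U})_T$ for some ultrafilter $\mathcal{U}$ in $\mathcal{B}$.
   Context: Rings are commutative with identity; subrings contain the identity of the big ring. Elements of $R$ are written $a=(a_\lambda)_{\lambda\in\Lambda}$. For a ring $D$, $\max(D)$ is the set of maximal ideals of $D$ and, for $a\in D$, $\mathscr{V}(a)=\{M\in\max(D)\mid a\in M\}$. $\mathcal{B}=\prod_{\lambda\in\Lambda}\mathcal{P}(\max(D_\lambda))$ is the product of the power set Boolean algebras, with componentwise $\cap$, $\cup$ and complement as operations $\land,\lor,\lnot$, least element $0_{\mathcal{B}}=(\emptyset)_{\lambda}$, and order $Y\le Z$ iff $Y_\lambda\subseteq Z_\lambda$ for all $\lambda$. An ultrafilter in $\mathcal{B}$ is a maximal proper filter of this Boolean algebra. A non-empty subset $M\subseteq\mathcal{B}$ has the finite intersection property if $Y_1\land\dots\land Y_n\neq 0_{\mathcal{B}}$ for all $Y_1,\dots,Y_n\in M$. For $a\in R$, $S(a)=(\mathscr{V}(a_\lambda))_{\lambda\in\Lambda}\in\mathcal{B}$.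 For an ultrafilter $\mathcal{U}$ in $\mathcal{B}$, $(\mathcal{U})_T=\{a\in T\mid S(a)\in\mathcal{U}\}$. The subring $T\subseteq R$ has the Skolem-property if for all $a^{(1)},\dots,a^{(n)}\in T$ such that the ideal $(a^{(1)}_\lambda,\dots,a^{(n)}_\lambda)$ equals $D_\lambda$ for all $\lambda\in\Lambda$, it follows that $(a^{(1)},\dots,a^{(n)})=T$ (ideal generated in $T$). *)

theory Defs
  imports "HOL-Algebra.Algebra"
begin

text \<open>Elements are extensional functions on the index set, as for the library's product of groups.\<close>

definition ring_prod :: "'i set \<Rightarrow> ('i \<Rightarrow> ('a, 'm) ring_scheme) \<Rightarrow> ('i \<Rightarrow> 'a) ring" where
  "ring_prod \<Lambda> D =
     \<lparr>carrier = (\<Pi>\<^sub>E l\<in>\<Lambda>. carrier (D l)),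
      monoid.mult = (\<lambda>a b. \<lambda>l\<in>\<Lambda>. a l \<otimes>\<^bsub>D l\<^esub> b l),
      monoid.one = (\<lambda>l\<in>\<Lambda>. \<one>\<^bsub>D l\<^esub>),
      ring.zero = (\<lambda>l\<in>\<Lambda>. \<zero>\<^bsub>D l\<^esub>),
      ring.add = (\<lambda>a b. \<lambda>l\<in>\<Lambda>. a l \<oplus>\<^bsub>D l\<^esub> b l)\<rparr>"

lemma ring_prod_cring:
  assumes D: "\<And>l. l \<in> \<Lambda> \<Longrightarrow> cring (D l)"
  shows "cring (ring_prod \<Lambda> D)"
proof -
  have R: "ring (D l)" if "l \<in> \<Lambda>" for l
    using D[OF that] by (rule cring.axioms(1))
  have M: "monoid (D l)" if "l \<in> \<Lambda>" for l
    using R[OF that] by (rule ring.is_monoid)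
  have inv: "\<exists>b \<in> (\<Pi>\<^sub>E l\<in>\<Lambda>. carrier (D l)). (\<lambda>l\<in>\<Lambda>. b l \<oplus>\<^bsub>D l\<^esub> a l) = (\<lambda>l\<in>\<Lambda>. \<zero>\<^bsub>D l\<^esub>)"
    if a: "a \<in> (\<Pi>\<^sub>E l\<in>\<Lambda>. carrier (D l))" for a
  proof
    show "(\<lambda>l\<in>\<Lambda>. \<ominus>\<^bsub>D l\<^esub> a l) \<in> (\<Pi>\<^sub>E l\<in>\<Lambda>. carrier (D l))"
      using a by (auto intro!: abelian_group.a_inv_closed ring.is_abelian_group R)
    show "(\<lambda>l\<in>\<Lambda>. (\<lambda>l\<in>\<Lambda>. \<ominus>\<^bsub>D l\<^esub> a l) l \<oplus>\<^bsub>D l\<^esub> a l) = (\<lambda>l\<in>\<Lambda>. \<zero>\<^bsub>D l\<^esub>)"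
      using a by (auto intro!: restrict_ext abelian_group.l_neg ring.is_abelian_group R)
  qed
  show ?thesis
  proof (rule cringI)
    show "abelian_group (ring_prod \<Lambda> D)"
    proof (rule abelian_groupI)
      fix a assume "a \<in> carrier (ring_prod \<Lambda> D)"
      then show "\<exists>b\<in>carrier (ring_prod \<Lambda> D). b \<oplus>\<^bsub>ring_prod \<Lambda> D\<^esub> a = \<zero>\<^bsub>ring_prod \<Lambda> D\<^esub>"
        using inv[of a] by (simp add: ring_prod_def)
    qed (auto simp: ring_prod_def PiE_iff fun_eq_iff extensional_def
          intro: ring.ring_simprules R)
    show "Group.comm_monoid (ring_prod \<Lambda> D)"
      by (rule comm_monoidI)
        (auto simp: ring_prod_def PiE_iff fun_eq_iff extensional_def
          intro: monoid.m_closed monoid.one_closed monoid.m_assoc monoid.l_one cring.cring_simprules(14) M D)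
    fix a b c
    assume "a \<in> carrier (ring_prod \<Lambda> D)" "b \<in> carrier (ring_prod \<Lambda> D)" "c \<in> carrier (ring_prod \<Lambda> D)"
    then show "(a \<oplus>\<^bsub>ring_prod \<Lambda> D\<^esub> b) \<otimes>\<^bsub>ring_prod \<Lambda> D\<^esub> c
       = a \<otimes>\<^bsub>ring_prod \<Lambda> D\<^esub> c \<oplus>\<^bsub>ring_prod \<Lambda> D\<^esub> b \<otimes>\<^bsub>ring_prod \<Lambda> D\<^esub> c"
      by (auto simp: ring_prod_def PiE_iff fun_eq_iff intro: ring.ring_simprules R)
  qed
qed

definition max_spec :: "('a, 'm) ring_scheme \<Rightarrow> 'a set set" where
  "max_spec R = {M. maximalideal M R}"

definition vanish :: "('a, 'm) ring_scheme \<Rightarrow> 'a \<Rightarrow> 'a set set" where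
  "vanish R a = {M \<in> max_spec R. a \<in> M}"

definition BA :: "'i set \<Rightarrow> ('i \<Rightarrow> ('a, 'm) ring_scheme) \<Rightarrow> ('i \<Rightarrow> 'a set set) set" where
  "BA \<Lambda> D = (\<Pi>\<^sub>E l\<in>\<Lambda>. Pow (max_spec (D l)))"

definition BA_zero :: "'i set \<Rightarrow> 'i \<Rightarrow> 'a set set" where
  "BA_zero \<Lambda> = (\<lambda>l\<in>\<Lambda>. {})"

definition BA_meet :: "'i set \<Rightarrow> ('i \<Rightarrow> 'a set set) \<Rightarrow> ('i \<Rightarrow> 'a set set) \<Rightarrow> 'i \<Rightarrow> 'a set set" where
  "BA_meet \<Lambda> Y Z = (\<lambda>l\<in>\<Lambda>. Y l \<inter> Z l)"

definition BA_le :: "'i set \<Rightarrow> ('i \<Rightarrow> 'a set set) \<Rightarrow> ('i \<Rightarrow> 'a set set) \<Rightarrow> bool" where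
  "BA_le \<Lambda> Y Z \<longleftrightarrow> (\<forall>l\<in>\<Lambda>. Y l \<subseteq> Z l)"

definition BA_filter :: "'i set \<Rightarrow> ('i \<Rightarrow> ('a, 'm) ring_scheme) \<Rightarrow> ('i \<Rightarrow> 'a set set) set \<Rightarrow> bool" where
  "BA_filter \<Lambda> D F \<longleftrightarrow>
     F \<subseteq> BA \<Lambda> D \<and> F \<noteq> {} \<and>
     (\<forall>Y\<in>F. \<forall>Z\<in>F. BA_meet \<Lambda> Y Z \<in> F) \<and>
     (\<forall>Y\<in>F. \<forall>Z\<in>BA \<Lambda> D. BA_le \<Lambda> Y Z \<longrightarrow> Z \<in> F)"

definition BA_proper_filter :: "'i set \<Rightarrow> ('i \<Rightarrow> ('a, 'm) ring_scheme) \<Rightarrow> ('i \<Rightarrow> 'a set set) set \<Rightarrow> bool" where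
  "BA_proper_filter \<Lambda> D F \<longleftrightarrow> BA_filter \<Lambda> D F \<and> F \<noteq> BA \<Lambda> D"

definition BA_ultrafilter :: "'i set \<Rightarrow> ('i \<Rightarrow> ('a, 'm) ring_scheme) \<Rightarrow> ('i \<Rightarrow> 'a set set) set \<Rightarrow> bool" where
  "BA_ultrafilter \<Lambda> D U \<longleftrightarrow>
     BA_proper_filter \<Lambda> D U \<and> (\<forall>F. BA_proper_filter \<Lambda> D F \<and> U \<subseteq> F \<longrightarrow> F = U)"

text \<open>In the next definition the intersection over \<open>{1..n}\<close> with \<open>n \<ge> 1\<close> is the componentwise form
  of the iterated meet of \<open>Y 1, \<dots>, Y n\<close>.\<close>

definition finite_intersection_property ::
    "'i set \<Rightarrow> ('i \<Rightarrow> ('a, 'm) ring_scheme) \<Rightarrow> ('i \<Rightarrow> 'a set set) set \<Rightarrow> bool" where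
  "finite_intersection_property \<Lambda> D M \<longleftrightarrow>
     M \<subseteq> BA \<Lambda> D \<and> M \<noteq> {} \<and>
     (\<forall>(n::nat) Y. n \<ge> 1 \<and> (\<forall>k\<in>{1..n}. Y k \<in> M) \<longrightarrow>
        (\<lambda>l\<in>\<Lambda>. \<Inter>k\<in>{1..n}. Y k l) \<noteq> BA_zero \<Lambda>)"

definition S_map :: "'i set \<Rightarrow> ('i \<Rightarrow> ('a, 'm) ring_scheme) \<Rightarrow> ('i \<Rightarrow> 'a) \<Rightarrow> 'i \<Rightarrow> 'a set set" where
  "S_map \<Lambda> D a = (\<lambda>l\<in>\<Lambda>. vanish (D l) (a l))"

definition ultra_ideal ::
    "'i set \<Rightarrow> ('i \<Rightarrow> ('a, 'm) ring_scheme) \<Rightarrow> ('i \<Rightarrow> 'a) set \<Rightarrow> ('i \<Rightarrow> 'a set set) set \<Rightarrow> ('i \<Rightarrow> 'a) set" where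
  "ultra_ideal \<Lambda> D T U = {a \<in> T. S_map \<Lambda> D a \<in> U}"

abbreviation subring_of_prod ::
    "'i set \<Rightarrow> ('i \<Rightarrow> ('a, 'm) ring_scheme) \<Rightarrow> ('i \<Rightarrow> 'a) set \<Rightarrow> ('i \<Rightarrow> 'a) ring" where
  "subring_of_prod \<Lambda> D T \<equiv> (ring_prod \<Lambda> D)\<lparr>carrier := T\<rparr>"

definition skolem_property :: "'i set \<Rightarrow> ('i \<Rightarrow> ('a, 'm) ring_scheme) \<Rightarrow> ('i \<Rightarrow> 'a) set \<Rightarrow> bool" where
  "skolem_property \<Lambda> D T \<longleftrightarrow>
     (\<forall>(n::nat) a. n \<ge> 1 \<and> (\<forall>k\<in>{1..n}. a k \<in> T) \<and>
        (\<forall>l\<in>\<Lambda>. Idl\<^bsub>D l\<^esub> ((\<lambda>k. a k l) ` {1..n}) = carrier (D l)) \<longrightarrow>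
        Idl\<^bsub>subring_of_prod \<Lambda> D T\<^esub> (a ` {1..n}) = T)"

end

theory Submission
  imports Defs
begin

text \<open>By Zorn's lemma, elements of a ring generate the unit ideal iff no maximal ideal contains them
  all. Hence the Skolem property says exactly that finitely many \<open>a \<in> T\<close> whose \<open>S(a)\<close> have meet
  \<open>0\<close> generate \<open>T\<close>, and this is the finite intersection property for proper ideals. A set with
  the finite intersection property extends to an ultrafilter \<open>U\<close>; as \<open>U\<close> does not contain \<open>S(1) = 0\<close>,
  the ideal \<open>(U)\<^sub>T\<close> is proper, so it equals every maximal ideal that it contains.
  Conversely, elements of \<open>(U)\<^sub>T\<close> never have \<open>S\<close>-values with meet \<open>0\<close>, which
  leads back to the Skolem property by placing a proper ideal into a maximal one.\<close>

section \<open>Maximal ideals and generation of the unit ideal\<close>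

text \<open>Zorn's lemma for the ideals above \<open>I\<close> that miss \<open>\<one>\<close>. For
  ideals, missing \<open>\<one>\<close> is the same as being proper, and it visibly passes to unions
  of chains.\<close>

lemma (in ring) ex_maximalideal_superset:
  assumes I: "ideal I R" and proper: "I \<noteq> carrier R"
  shows "\<exists>M. maximalideal M R \<and> I \<subseteq> M"
proof -
  define A where "A = {J. ideal J R \<and> I \<subseteq> J \<and> \<one> \<notin> J}"
  have one: "\<one> \<notin> J" if "ideal J R" "J \<noteq> carrier R" for J
    using that ideal.one_imp_carrier by blast
  have "\<exists>M\<in>A. \<forall>J\<in>A. M \<subseteq> J \<longrightarrow> J = M"
  proof (rule subset_Zorn_nonempty)
    show "A \<noteq> {}"
      using I one[OF I proper] by (auto simp: A_def)
    fix C assume C: "C \<noteq> {}" "subset.chain A C"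
    then have "subset.chain {J. ideal J R} C"
      by (auto simp: A_def subset_chain_def)
    \<comment> \<open>Nonemptiness of \<open>C\<close> matters: the union of the empty chain is the
      empty set, which is no ideal.\<close>
    then have "ideal (\<Union>C) R"
      using chain_Union_is_ideal[of C] C(1) by simp
    then show "\<Union>C \<in> A"
      using C by (auto simp: A_def subset_chain_def)
  qed
  then obtain M where M: "M \<in> A" and max: "\<And>J. J \<in> A \<Longrightarrow> M \<subseteq> J \<Longrightarrow> J = M"
    by blast
  have "maximalideal M R"
  proof (rule maximalidealI)
    show "ideal M R"
      using M by (simp add: A_def)
    show "carrier R \<noteq> M"
      using M by (auto simp: A_def)
    fix J assume J: "ideal J R" "M \<subseteq> J" "J \<subseteq> carrier R"
    show "J = M \<or> J = carrier R"
      using max[of J] one[OF J(1)] J M by (auto simp: A_def)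
  qed
  then show ?thesis
    using M by (auto simp: A_def)
qed

text \<open>A maximal ideal containing \<open>S\<close> contains \<open>Idl S\<close>, so
  \<open>Idl S\<close> is proper; conversely, a proper \<open>Idl S\<close> lies in some maximal
  ideal.\<close>

lemma (in ring) genideal_eq_carrier_iff:
  assumes S: "S \<subseteq> carrier R"
  shows "Idl S = carrier R \<longleftrightarrow> (\<nexists>M. maximalideal M R \<and> S \<subseteq> M)"
proof
  assume eq: "Idl S = carrier R"
  show "\<nexists>M. maximalideal M R \<and> S \<subseteq> M"
  proof
    assume "\<exists>M. maximalideal M R \<and> S \<subseteq> M"
    then obtain M where M: "maximalideal M R" "S \<subseteq> M" by blast
    interpret M: maximalideal M R by (rule M(1))
    have "carrier R \<subseteq> M"
      using genideal_minimal[OF M.is_ideal M(2)] eq by simp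
    then show False
      using M.I_notcarr M.a_subset by blast
  qed
next
  assume none: "\<nexists>M. maximalideal M R \<and> S \<subseteq> M"
  show "Idl S = carrier R"
    using ex_maximalideal_superset[OF genideal_ideal[OF S]] genideal_self[OF S] none
    by (meson subset_trans)
qed

text \<open>The same criterion in terms of vanishing sets. For empty \<open>S\<close> the
  intersection would be the universe of the type instead of \<open>max_spec R\<close>, hence the
  assumption \<open>S \<noteq> {}\<close>.\<close>

lemma (in ring) genideal_eq_carrier_iff_vanish:
  assumes "S \<subseteq> carrier R" "S \<noteq> {}"
  shows "Idl S = carrier R \<longleftrightarrow> (\<Inter>a\<in>S. vanish R a) = {}"
  using assms(2) unfolding genideal_eq_carrier_iff[OF assms(1)]
  by (auto simp: vanish_def max_spec_def)

lemma (in ring) idealI_closed: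
  assumes sub: "I \<subseteq> carrier R" and ne: "I \<noteq> {}"
    and add: "\<And>a b. a \<in> I \<Longrightarrow> b \<in> I \<Longrightarrow> a \<oplus> b \<in> I"
    and l: "\<And>a x. a \<in> I \<Longrightarrow> x \<in> carrier R \<Longrightarrow> x \<otimes> a \<in> I"
    and r: "\<And>a x. a \<in> I \<Longrightarrow> x \<in> carrier R \<Longrightarrow> a \<otimes> x \<in> I"
  shows "ideal I R"
proof (rule idealI)
  \<comment> \<open>Additive inverses come from multiplication by the negative of
    \<open>\<one>\<close>.\<close>
  have "\<ominus> a \<in> I" if "a \<in> I" for a
    using l[OF that, of "\<ominus> \<one>"] that sub by (simp add: l_minus subset_iff)
  then show "subgroup I (add_monoid R)"
    using sub ne add by (intro add.subgroupI) (auto simp: a_inv_def)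
qed (use l r ring_axioms in auto)

section \<open>Vanishing sets under the ring operations\<close>

lemma vanish_add:
  "vanish R a \<inter> vanish R b \<subseteq> vanish R (a \<oplus>\<^bsub>R\<^esub> b)"
  by (auto simp: vanish_def max_spec_def maximalideal_def ideal_def additive_subgroup.a_closed)

lemma vanish_mult:
  assumes "x \<in> carrier R"
  shows "vanish R a \<subseteq> vanish R (x \<otimes>\<^bsub>R\<^esub> a)" "vanish R a \<subseteq> vanish R (a \<otimes>\<^bsub>R\<^esub> x)"
  using assms by (auto simp: vanish_def max_spec_def maximalideal_def ideal.I_l_closed ideal.I_r_closed)

lemma vanish_zero: "vanish R \<zero>\<^bsub>R\<^esub> = max_spec R"
  by (auto simp: vanish_def max_spec_def maximalideal_def ideal_def additive_subgroup.zero_closed)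

lemma vanish_one: "vanish R \<one>\<^bsub>R\<^esub> = {}"
  using ideal.one_imp_carrier maximalideal.I_notcarr maximalideal.axioms(1)
  by (fastforce simp: vanish_def max_spec_def)

lemma S_map_in_BA: "S_map \<Lambda> D a \<in> BA \<Lambda> D"
  by (auto simp: S_map_def BA_def vanish_def)

section \<open>The finite intersection property in terms of finite sets\<close>

text \<open>Allows the tuples indexed by \<open>{1..n}\<close> in the definitions of the finite
  intersection property and the Skolem property to be replaced by finite nonempty sets.\<close>

lemma finite_nonempty_iff_image:
  "finite F \<and> F \<noteq> {} \<longleftrightarrow> (\<exists>(n::nat) f. n \<ge> 1 \<and> F = f ` {1..n})"
proof
  assume F: "finite F \<and> F \<noteq> {}"
  then obtain f where "bij_betw f {1..card F} F"
    using ex_bij_betw_nat_finite_1 by blast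
  moreover have "card F \<ge> 1"
    using F by (simp add: Suc_leI card_gt_0_iff)
  ultimately show "\<exists>(n::nat) f. n \<ge> 1 \<and> F = f ` {1..n}"
    by (metis bij_betw_imp_surj_on)
qed auto

lemma finite_intersection_property_iff:
  "finite_intersection_property \<Lambda> D M \<longleftrightarrow>
     M \<subseteq> BA \<Lambda> D \<and> M \<noteq> {} \<and>
     (\<forall>F. finite F \<and> F \<noteq> {} \<and> F \<subseteq> M \<longrightarrow> (\<exists>l\<in>\<Lambda>. (\<Inter>Y\<in>F. Y l) \<noteq> {}))"
proof -
  \<comment> \<open>A meet is nonzero as soon as one component is nonempty; the index
    \<open>l\<close> may depend on the finite family.\<close>
  have zero: "(\<lambda>l\<in>\<Lambda>. \<Inter>k\<in>{1..n}. Y k l) \<noteq> BA_zero \<Lambda> \<longleftrightarrow> (\<exists>l\<in>\<Lambda>. (\<Inter>Z\<in>Y ` {1..n}. Z l) \<noteq> {})"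
    for n :: nat and Y :: "nat \<Rightarrow> 'a \<Rightarrow> 'b set set"
    by (auto simp: BA_zero_def fun_eq_iff restrict_def)
  have "(\<forall>(n::nat) Y. n \<ge> 1 \<and> (\<forall>k\<in>{1..n}. Y k \<in> M) \<longrightarrow>
          (\<exists>l\<in>\<Lambda>. (\<Inter>Z\<in>Y ` {1..n}. Z l) \<noteq> {})) \<longleftrightarrow>
        (\<forall>F. finite F \<and> F \<noteq> {} \<and> F \<subseteq> M \<longrightarrow> (\<exists>l\<in>\<Lambda>. (\<Inter>Y\<in>F. Y l) \<noteq> {}))"
    (is "?L \<longleftrightarrow> ?R")
  proof
    assume L: ?L
    show ?R
    proof (intro allI impI)
      fix F assume F: "finite F \<and> F \<noteq> {} \<and> F \<subseteq> M"
      then obtain n :: nat and Y where "n \<ge> 1" and eq: "F = Y ` {1..n}"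
        using finite_nonempty_iff_image[of F] by blast
      then show "\<exists>l\<in>\<Lambda>. (\<Inter>Y\<in>F. Y l) \<noteq> {}"
        using L[rule_format, of n Y] F unfolding eq by blast
    qed
  next
    assume R: ?R
    show ?L
    proof (intro allI impI)
      fix n :: nat and Y assume "n \<ge> 1 \<and> (\<forall>k\<in>{1..n}. Y k \<in> M)"
      then show "\<exists>l\<in>\<Lambda>. (\<Inter>Z\<in>Y ` {1..n}. Z l) \<noteq> {}"
        by (intro R[rule_format]) auto
    qed
  qed
  then show ?thesis
    unfolding finite_intersection_property_def zero by (simp only:)
qed

section \<open>Filters and ultrafilters in the product Boolean algebra\<close>

text \<open>The least element lies below everything, so an upward closed set containing it is all of
  \<open>BA \<Lambda> D\<close>.\<close>

lemma BA_proper_filter_iff: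
  "BA_proper_filter \<Lambda> D F \<longleftrightarrow> BA_filter \<Lambda> D F \<and> BA_zero \<Lambda> \<notin> F"
proof
  assume P: "BA_proper_filter \<Lambda> D F"
  then have F: "BA_filter \<Lambda> D F" "F \<noteq> BA \<Lambda> D"
    by (simp_all add: BA_proper_filter_def)
  have sub: "F \<subseteq> BA \<Lambda> D"
    using F(1) by (simp add: BA_filter_def)
  have "BA \<Lambda> D \<subseteq> F" if "BA_zero \<Lambda> \<in> F"
  proof
    fix Z assume "Z \<in> BA \<Lambda> D"
    moreover have "BA_le \<Lambda> (BA_zero \<Lambda>) Z"
      by (simp add: BA_le_def BA_zero_def)
    ultimately show "Z \<in> F"
      using F(1) that by (simp add: BA_filter_def)
  qed
  then show "BA_filter \<Lambda> D F \<and> BA_zero \<Lambda> \<notin> F"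
    using F(1,2) sub by blast
next
  assume "BA_filter \<Lambda> D F \<and> BA_zero \<Lambda> \<notin> F"
  moreover have "BA_zero \<Lambda> \<in> BA \<Lambda> D"
    by (auto simp: BA_zero_def BA_def)
  ultimately show "BA_proper_filter \<Lambda> D F"
    by (auto simp: BA_proper_filter_def)
qed

lemma BA_filter_finite_meet:
  assumes F: "BA_filter \<Lambda> D F" and G: "finite G" "G \<noteq> {}" "G \<subseteq> F"
  shows "(\<lambda>l\<in>\<Lambda>. \<Inter>Y\<in>G. Y l) \<in> F"
  using G
proof (induction G rule: finite_ne_induct)
  case (singleton Y)
  then have "Y \<in> BA \<Lambda> D"
    using F by (auto simp: BA_filter_def)
  \<comment> \<open>Members of \<open>BA \<Lambda> D\<close> are extensional, so restricting them to
    \<open>\<Lambda>\<close> changes nothing.\<close>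
  then have "(\<lambda>l\<in>\<Lambda>. Y l) = Y"
    by (auto simp: BA_def PiE_iff extensional_restrict)
  then show ?case
    using singleton by simp
next
  case (insert Y G)
  have "BA_meet \<Lambda> Y (\<lambda>l\<in>\<Lambda>. \<Inter>Z\<in>G. Z l) \<in> F"
    using insert F unfolding BA_filter_def by blast
  moreover have "(\<lambda>l\<in>\<Lambda>. \<Inter>Z\<in>insert Y G. Z l) = BA_meet \<Lambda> Y (\<lambda>l\<in>\<Lambda>. \<Inter>Z\<in>G. Z l)"
    by (auto simp: BA_meet_def fun_eq_iff restrict_def)
  ultimately show ?case
    by (simp only:)
qed

text \<open>Finite meets of members stay in \<open>F\<close>, and a proper filter misses
  \<open>BA_zero \<Lambda>\<close>.\<close>

lemma BA_proper_filter_imp_fip: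
  assumes F: "BA_proper_filter \<Lambda> D F"
  shows "finite_intersection_property \<Lambda> D F"
  unfolding finite_intersection_property_iff
proof (intro conjI allI impI)
  show "F \<subseteq> BA \<Lambda> D" "F \<noteq> {}"
    using F by (simp_all add: BA_proper_filter_def BA_filter_def)
  fix G assume G: "finite G \<and> G \<noteq> {} \<and> G \<subseteq> F"
  have "(\<lambda>l\<in>\<Lambda>. \<Inter>Y\<in>G. Y l) \<noteq> BA_zero \<Lambda>"
    using BA_filter_finite_meet[of \<Lambda> D F G] F G unfolding BA_proper_filter_iff by metis
  then show "\<exists>l\<in>\<Lambda>. (\<Inter>Y\<in>G. Y l) \<noteq> {}"
    unfolding BA_zero_def by (metis (no_types, lifting) restrict_ext)
qed

text \<open>Zorn's lemma is applied to sets with the finite intersection property rather than to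
  filters, so no generated filter has to be constructed; a maximal such set turns out to be a
  filter.\<close>

lemma ex_BA_ultrafilter_superset:
  assumes M: "finite_intersection_property \<Lambda> D M"
  shows "\<exists>U. BA_ultrafilter \<Lambda> D U \<and> M \<subseteq> U"
proof -
  define A where "A = {N. finite_intersection_property \<Lambda> D N \<and> M \<subseteq> N}"
  have "\<exists>U\<in>A. \<forall>N\<in>A. U \<subseteq> N \<longrightarrow> N = U"
  proof (rule subset_Zorn_nonempty)
    show "A \<noteq> {}"
      using M by (auto simp: A_def)
    fix C assume C: "C \<noteq> {}" "subset.chain A C"
    have fip: "\<And>N. N \<in> C \<Longrightarrow> finite_intersection_property \<Lambda> D N" and sup: "\<And>N. N \<in> C \<Longrightarrow> M \<subseteq> N"
      using C(2) by (auto simp: A_def subset_chain_def)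
    have "\<exists>l\<in>\<Lambda>. (\<Inter>Y\<in>F. Y l) \<noteq> {}" if F: "finite F" "F \<noteq> {}" "F \<subseteq> \<Union>C" for F
    proof -
      \<comment> \<open>A finite subset of the union of a chain already lies in one member of the
        chain.\<close>
      obtain N where "N \<in> C" "F \<subseteq> N"
        using finite_subset_Union_chain[OF F(1,3) C] by blast
      then show ?thesis
        using fip[of N] F by (auto simp: finite_intersection_property_iff)
    qed
    moreover have "N \<subseteq> BA \<Lambda> D" "N \<noteq> {}" if "N \<in> C" for N
      using fip[OF that] by (simp_all add: finite_intersection_property_iff)
    then have "\<Union>C \<subseteq> BA \<Lambda> D" "\<Union>C \<noteq> {}"
      using C(1) by blast+
    ultimately have "finite_intersection_property \<Lambda> D (\<Union>C)"
      by (simp add: finite_intersection_property_iff)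
    then show "\<Union>C \<in> A"
      using C(1) sup by (auto simp: A_def)
  qed
  then obtain U where U: "finite_intersection_property \<Lambda> D U" "M \<subseteq> U"
    and max: "\<And>N. finite_intersection_property \<Lambda> D N \<Longrightarrow> U \<subseteq> N \<Longrightarrow> N = U"
    by (auto simp: A_def)
  have sub: "U \<subseteq> BA \<Lambda> D" and ne: "U \<noteq> {}"
    and ex: "\<And>F. finite F \<Longrightarrow> F \<noteq> {} \<Longrightarrow> F \<subseteq> U \<Longrightarrow> \<exists>l\<in>\<Lambda>. (\<Inter>Y\<in>F. Y l) \<noteq> {}"
    using U(1) by (auto simp: finite_intersection_property_iff)
  \<comment> \<open>By maximality, \<open>U\<close> contains everything above a finite meet of its members.\<close>
  have above: "Z \<in> U"
    if Z: "Z \<in> BA \<Lambda> D" and G: "finite G" "G \<noteq> {}" "G \<subseteq> U"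
      and le: "\<And>l. l \<in> \<Lambda> \<Longrightarrow> (\<Inter>Y\<in>G. Y l) \<subseteq> Z l" for Z G
  proof -
    have "\<exists>l\<in>\<Lambda>. (\<Inter>Y\<in>F. Y l) \<noteq> {}" if F: "finite F" "F \<subseteq> insert Z U" for F
    proof -
      \<comment> \<open>Trading \<open>Z\<close> for \<open>G\<close> gives a family inside
        \<open>U\<close> whose meet is at most that of \<open>F\<close>. It is nonempty because
        \<open>G\<close> is, even if \<open>F\<close> is empty or equal to
        \<open>{Z}\<close>.\<close>
      have "finite ((F - {Z}) \<union> G)" "(F - {Z}) \<union> G \<noteq> {}" "(F - {Z}) \<union> G \<subseteq> U"
        using F G by auto
      then obtain l where l: "l \<in> \<Lambda>" "(\<Inter>Y\<in>(F - {Z}) \<union> G. Y l) \<noteq> {}"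
        using ex by meson
      have "(\<Inter>Y\<in>(F - {Z}) \<union> G. Y l) \<subseteq> (\<Inter>Y\<in>F. Y l)"
        using le[OF l(1)] by blast
      then show ?thesis
        using l by blast
    qed
    then have "finite_intersection_property \<Lambda> D (insert Z U)"
      using Z sub by (simp add: finite_intersection_property_iff)
    then show ?thesis
      using max[of "insert Z U"] by blast
  qed
  have "BA_filter \<Lambda> D U"
    unfolding BA_filter_def
  proof (intro conjI ballI impI)
    fix Y Z assume YZ: "Y \<in> U" "Z \<in> U"
    then have "BA_meet \<Lambda> Y Z \<in> BA \<Lambda> D"
      using sub by (auto simp: BA_meet_def BA_def PiE_iff subset_iff)
    then show "BA_meet \<Lambda> Y Z \<in> U"
      using YZ by (intro above[of _ "{Y, Z}"]) (auto simp: BA_meet_def)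
  next
    fix Y Z assume "Y \<in> U" "Z \<in> BA \<Lambda> D" "BA_le \<Lambda> Y Z"
    then show "Z \<in> U"
      by (intro above[of _ "{Y}"]) (auto simp: BA_le_def)
  qed (use sub ne in auto)
  moreover have "BA_zero \<Lambda> \<notin> U"
    using ex[of "{BA_zero \<Lambda>}"] by (auto simp: BA_zero_def)
  \<comment> \<open>Every proper filter has the finite intersection property, so maximality of
    \<open>U\<close> among sets with that property includes maximality among proper filters.\<close>
  ultimately have "BA_ultrafilter \<Lambda> D U"
    using max BA_proper_filter_imp_fip unfolding BA_ultrafilter_def by (metis BA_proper_filter_iff)
  then show ?thesis
    using U(2) by blast
qed

section \<open>The Skolem property as a statement about meets of \<open>S_map\<close> values\<close>

lemma skolem_property_iff:
  "skolem_property \<Lambda> D T \<longleftrightarrow>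
     (\<forall>F. finite F \<and> F \<noteq> {} \<and> F \<subseteq> T \<and>
        (\<forall>l\<in>\<Lambda>. Idl\<^bsub>D l\<^esub> ((\<lambda>a. a l) ` F) = carrier (D l)) \<longrightarrow>
        Idl\<^bsub>subring_of_prod \<Lambda> D T\<^esub> F = T)" (is "_ \<longleftrightarrow> ?R")
proof
  assume L: "skolem_property \<Lambda> D T"
  show ?R
  proof (intro allI impI)
    fix F assume F: "finite F \<and> F \<noteq> {} \<and> F \<subseteq> T \<and>
      (\<forall>l\<in>\<Lambda>. Idl\<^bsub>D l\<^esub> ((\<lambda>a. a l) ` F) = carrier (D l))"
    then obtain n :: nat and a where n: "n \<ge> 1" and eq: "F = a ` {1..n}"
      using finite_nonempty_iff_image[of F] by blast
    then show "Idl\<^bsub>subring_of_prod \<Lambda> D T\<^esub> F = T"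
      using L[unfolded skolem_property_def, rule_format, of n a] F
      by (simp add: image_image image_subset_iff)
  qed
next
  assume R: ?R
  show "skolem_property \<Lambda> D T"
    unfolding skolem_property_def
  proof (intro allI impI)
    fix n :: nat and a
    assume "n \<ge> 1 \<and> (\<forall>k\<in>{1..n}. a k \<in> T) \<and>
      (\<forall>l\<in>\<Lambda>. Idl\<^bsub>D l\<^esub> ((\<lambda>k. a k l) ` {1..n}) = carrier (D l))"
    then show "Idl\<^bsub>subring_of_prod \<Lambda> D T\<^esub> (a ` {1..n}) = T"
      by (intro R[rule_format]) (auto simp: image_image)
  qed
qed

locale subring_of_product =
  fixes \<Lambda> :: "'i set" and D :: "'i \<Rightarrow> ('a, 'm) ring_scheme" and T :: "('i \<Rightarrow> 'a) set"
  assumes cring_factor: "\<And>l. l \<in> \<Lambda> \<Longrightarrow> cring (D l)"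
    and subring_T: "subring T (ring_prod \<Lambda> D)"
begin

sublocale T: ring "subring_of_prod \<Lambda> D T"
  using ring.subring_is_ring[OF cring.axioms(1)[OF ring_prod_cring[OF cring_factor]] subring_T] .

lemma T_component: "a \<in> T \<Longrightarrow> l \<in> \<Lambda> \<Longrightarrow> a l \<in> carrier (D l)"
  using subringE(1)[OF subring_T] by (auto simp: ring_prod_def)

text \<open>The bridge from ideals to the Boolean algebra: at \<open>l\<close>, \<open>S_map\<close>
  is the vanishing set of the component in \<open>D l\<close>, so the criterion for generating the
  unit ideal applies in each factor.\<close>

lemma genideal_component_eq_carrier_iff:
  assumes "l \<in> \<Lambda>" "F \<subseteq> T" "F \<noteq> {}"
  shows "Idl\<^bsub>D l\<^esub> ((\<lambda>a. a l) ` F) = carrier (D l) \<longleftrightarrow> (\<Inter>Y\<in>S_map \<Lambda> D ` F. Y l) = {}"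
proof -
  interpret D: cring "D l" by (rule cring_factor[OF assms(1)])
  have "(\<lambda>a. a l) ` F \<subseteq> carrier (D l)"
    using T_component[OF _ assms(1)] assms(2) by blast
  then show ?thesis
    using D.genideal_eq_carrier_iff_vanish[of "(\<lambda>a. a l) ` F"] assms(1,3) by (simp add: S_map_def)
qed

lemma skolem_property_iff_S_map:
  "skolem_property \<Lambda> D T \<longleftrightarrow>
     (\<forall>F. finite F \<and> F \<noteq> {} \<and> F \<subseteq> T \<and> (\<forall>l\<in>\<Lambda>. (\<Inter>Y\<in>S_map \<Lambda> D ` F. Y l) = {}) \<longrightarrow>
        Idl\<^bsub>subring_of_prod \<Lambda> D T\<^esub> F = T)"
proof -
  have "(\<forall>l\<in>\<Lambda>. Idl\<^bsub>D l\<^esub> ((\<lambda>a. a l) ` F) = carrier (D l)) \<longleftrightarrow>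
      (\<forall>l\<in>\<Lambda>. (\<Inter>Y\<in>S_map \<Lambda> D ` F. Y l) = {})" if "F \<noteq> {}" "F \<subseteq> T" for F
    using genideal_component_eq_carrier_iff[OF _ that(2,1)] by (intro ball_cong refl)
  then show ?thesis
    \<comment> \<open>The congruence rule makes \<open>F \<noteq> {}\<close> and
      \<open>F \<subseteq> T\<close> available while the last conjunct is rewritten.\<close>
    unfolding skolem_property_iff by (simp only: not_False_eq_True cong: conj_cong)
qed

section \<open>Ideals of \<open>T\<close> defined by filters\<close>

lemma S_map_one: "S_map \<Lambda> D \<one>\<^bsub>subring_of_prod \<Lambda> D T\<^esub> = BA_zero \<Lambda>"
  by (auto simp: S_map_def BA_zero_def ring_prod_def vanish_one fun_eq_iff restrict_def)

text \<open>Zero lies in every maximal ideal, so its \<open>S_map\<close> value is the top element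
  and belongs to every filter.\<close>

lemma S_map_zero_ge: "BA_le \<Lambda> Y (S_map \<Lambda> D \<zero>\<^bsub>subring_of_prod \<Lambda> D T\<^esub>)" if "Y \<in> BA \<Lambda> D"
  using that by (auto simp: S_map_def BA_le_def ring_prod_def vanish_zero BA_def)

lemma S_map_add:
  "BA_le \<Lambda> (BA_meet \<Lambda> (S_map \<Lambda> D a) (S_map \<Lambda> D b)) (S_map \<Lambda> D (a \<oplus>\<^bsub>subring_of_prod \<Lambda> D T\<^esub> b))"
  by (auto simp: S_map_def BA_le_def BA_meet_def ring_prod_def intro!: subsetD[OF vanish_add])

lemma S_map_mult:
  assumes "x \<in> T"
  shows "BA_le \<Lambda> (S_map \<Lambda> D a) (S_map \<Lambda> D (x \<otimes>\<^bsub>subring_of_prod \<Lambda> D T\<^esub> a))"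
    and "BA_le \<Lambda> (S_map \<Lambda> D a) (S_map \<Lambda> D (a \<otimes>\<^bsub>subring_of_prod \<Lambda> D T\<^esub> x))"
  by (auto simp: S_map_def BA_le_def ring_prod_def T_component[OF assms] intro: subsetD[OF vanish_mult(1)]
      subsetD[OF vanish_mult(2)])

text \<open>The \<open>S_map\<close> value of a sum lies above the meet of the two values, and that
  of a product lies above the value of either factor; closure of \<open>U\<close> under meets and
  larger elements turns this into the ideal axioms.\<close>

lemma ultra_ideal_ideal:
  assumes U: "BA_filter \<Lambda> D U"
  shows "ideal (ultra_ideal \<Lambda> D T U) (subring_of_prod \<Lambda> D T)"
proof (rule T.idealI_closed)
  have up: "S_map \<Lambda> D a \<in> U" if "Y \<in> U" "BA_le \<Lambda> Y (S_map \<Lambda> D a)" for Y a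
    using U that S_map_in_BA unfolding BA_filter_def by blast
  obtain Y where Y: "Y \<in> U" "Y \<in> BA \<Lambda> D"
    using U unfolding BA_filter_def by blast
  show "ultra_ideal \<Lambda> D T U \<subseteq> carrier (subring_of_prod \<Lambda> D T)"
    by (auto simp: ultra_ideal_def)
  show "ultra_ideal \<Lambda> D T U \<noteq> {}"
    using up[OF Y(1) S_map_zero_ge[OF Y(2)]] T.zero_closed by (auto simp: ultra_ideal_def)
  fix a assume a: "a \<in> ultra_ideal \<Lambda> D T U"
  {
    fix b assume b: "b \<in> ultra_ideal \<Lambda> D T U"
    have "BA_meet \<Lambda> (S_map \<Lambda> D a) (S_map \<Lambda> D b) \<in> U"
      using U a b by (simp add: BA_filter_def ultra_ideal_def)
    then show "a \<oplus>\<^bsub>subring_of_prod \<Lambda> D T\<^esub> b \<in> ultra_ideal \<Lambda> D T U"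
      using up[OF _ S_map_add] T.a_closed[of a b] a b by (simp add: ultra_ideal_def)
  }
  fix x assume x: "x \<in> carrier (subring_of_prod \<Lambda> D T)"
  show "x \<otimes>\<^bsub>subring_of_prod \<Lambda> D T\<^esub> a \<in> ultra_ideal \<Lambda> D T U"
    using up[OF _ S_map_mult(1)] T.m_closed[of x a] a x by (simp add: ultra_ideal_def)
  show "a \<otimes>\<^bsub>subring_of_prod \<Lambda> D T\<^esub> x \<in> ultra_ideal \<Lambda> D T U"
    using up[OF _ S_map_mult(2)] T.m_closed[of a x] a x by (simp add: ultra_ideal_def)
qed

lemma ultra_ideal_proper:
  assumes "BA_proper_filter \<Lambda> D U"
  shows "ultra_ideal \<Lambda> D T U \<noteq> T"
proof -
  have "\<one>\<^bsub>subring_of_prod \<Lambda> D T\<^esub> \<notin> ultra_ideal \<Lambda> D T U"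
    unfolding ultra_ideal_def mem_Collect_eq S_map_one using assms by (simp add: BA_proper_filter_iff)
  then show ?thesis
    using T.one_closed by auto
qed

section \<open>The implications between the four assertions\<close>

text \<open>Finitely many elements of \<open>A\<close> whose values have meet zero would generate
  \<open>T\<close>, although the ideal they generate stays inside \<open>A\<close>.\<close>

lemma skolem_imp_fip:
  assumes sk: "skolem_property \<Lambda> D T" and A: "ideal A (subring_of_prod \<Lambda> D T)" "A \<noteq> T"
  shows "finite_intersection_property \<Lambda> D (S_map \<Lambda> D ` A)"
  unfolding finite_intersection_property_iff
proof (intro conjI allI impI)
  interpret A: ideal A "subring_of_prod \<Lambda> D T" by (rule A(1))
  show "S_map \<Lambda> D ` A \<subseteq> BA \<Lambda> D"
    using S_map_in_BA by blast
  show "S_map \<Lambda> D ` A \<noteq> {}"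
    using A.zero_closed by blast
  fix G assume G: "finite G \<and> G \<noteq> {} \<and> G \<subseteq> S_map \<Lambda> D ` A"
  then obtain F where F: "F \<subseteq> A" "finite F" "G = S_map \<Lambda> D ` F"
    using finite_subset_image by metis
  show "\<exists>l\<in>\<Lambda>. (\<Inter>Y\<in>G. Y l) \<noteq> {}"
  proof (rule ccontr)
    assume "\<not> ?thesis"
    then have "Idl\<^bsub>subring_of_prod \<Lambda> D T\<^esub> F = T"
      using sk[unfolded skolem_property_iff_S_map, rule_format, of F] F G A.a_subset by auto
    then show False
      using T.genideal_minimal[OF A(1) F(1)] A.a_subset A(2) by auto
  qed
qed

lemma fip_imp_ultra_ideal:
  assumes "finite_intersection_property \<Lambda> D (S_map \<Lambda> D ` A)" "A \<subseteq> T"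
  shows "\<exists>U. BA_ultrafilter \<Lambda> D U \<and> ideal (ultra_ideal \<Lambda> D T U) (subring_of_prod \<Lambda> D T) \<and>
    A \<subseteq> ultra_ideal \<Lambda> D T U"
proof -
  obtain U where U: "BA_ultrafilter \<Lambda> D U" "S_map \<Lambda> D ` A \<subseteq> U"
    using ex_BA_ultrafilter_superset[OF assms(1)] by blast
  then have "A \<subseteq> ultra_ideal \<Lambda> D T U"
    using assms(2) by (auto simp: ultra_ideal_def)
  moreover have "BA_filter \<Lambda> D U"
    using U(1) unfolding BA_ultrafilter_def BA_proper_filter_def by blast
  ultimately show ?thesis
    using U(1) ultra_ideal_ideal by blast
qed

text \<open>Maximality of \<open>A\<close> leaves only \<open>A\<close> and \<open>T\<close> as
  ideals above it, and \<open>T\<close> is excluded because a proper filter does not contain the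
  value of \<open>\<one>\<close>.\<close>

lemma maximalideal_eq_ultra_ideal:
  assumes A: "maximalideal A (subring_of_prod \<Lambda> D T)"
    and U: "BA_ultrafilter \<Lambda> D U" "A \<subseteq> ultra_ideal \<Lambda> D T U"
  shows "A = ultra_ideal \<Lambda> D T U"
proof -
  have P: "BA_proper_filter \<Lambda> D U" "BA_filter \<Lambda> D U"
    using U(1) by (simp_all add: BA_ultrafilter_def BA_proper_filter_def)
  have "ultra_ideal \<Lambda> D T U \<subseteq> T"
    by (auto simp: ultra_ideal_def)
  then show ?thesis
    using maximalideal.I_maximal[OF A ultra_ideal_ideal[OF P(2)] U(2)] ultra_ideal_proper[OF P(1)]
    by simp
qed

text \<open>If \<open>F\<close> did not generate \<open>T\<close>, some maximal ideal would contain
  \<open>F\<close>. This ideal comes from an ultrafilter, which then contains all values of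
  \<open>F\<close> and forces their meet to be nonzero.\<close>

lemma maximalideals_ultra_imp_skolem:
  assumes max: "\<And>A. maximalideal A (subring_of_prod \<Lambda> D T) \<Longrightarrow>
    \<exists>U. BA_ultrafilter \<Lambda> D U \<and> A = ultra_ideal \<Lambda> D T U"
  shows "skolem_property \<Lambda> D T"
  unfolding skolem_property_iff_S_map
proof (intro allI impI)
  fix F
  assume F: "finite F \<and> F \<noteq> {} \<and> F \<subseteq> T \<and> (\<forall>l\<in>\<Lambda>. (\<Inter>Y\<in>S_map \<Lambda> D ` F. Y l) = {})"
  have False if A: "maximalideal A (subring_of_prod \<Lambda> D T)" "F \<subseteq> A" for A
  proof -
    obtain U where U: "BA_ultrafilter \<Lambda> D U" "A = ultra_ideal \<Lambda> D T U"
      using max[OF A(1)] by blast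
    have "finite_intersection_property \<Lambda> D U"
      using U(1) BA_proper_filter_imp_fip unfolding BA_ultrafilter_def by blast
    moreover have "S_map \<Lambda> D ` F \<subseteq> U"
      using A(2) U(2) by (auto simp: ultra_ideal_def)
    moreover have "finite (S_map \<Lambda> D ` F)" "S_map \<Lambda> D ` F \<noteq> {}"
      using F by auto
    ultimately have "\<exists>l\<in>\<Lambda>. (\<Inter>Y\<in>S_map \<Lambda> D ` F. Y l) \<noteq> {}"
      unfolding finite_intersection_property_iff by metis
    then show False
      using F by blast
  qed
  then show "Idl\<^bsub>subring_of_prod \<Lambda> D T\<^esub> F = T"
    using T.genideal_eq_carrier_iff[of F] F by auto
qed

end

theorem proposition2p2:
  fixes \<Lambda> :: "'i set" and D :: "'i \<Rightarrow> ('a, 'm) ring_scheme" and T :: "('i \<Rightarrow> 'a) set"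
  assumes "\<And>l. l \<in> \<Lambda> \<Longrightarrow> cring (D l)"
    and "subring T (ring_prod \<Lambda> D)"
  shows
    "(skolem_property \<Lambda> D T
        \<longleftrightarrow> (\<forall>A. ideal A (subring_of_prod \<Lambda> D T) \<and> A \<noteq> T \<longrightarrow>
              finite_intersection_property \<Lambda> D (S_map \<Lambda> D ` A)))
     \<and> ((\<forall>A. ideal A (subring_of_prod \<Lambda> D T) \<and> A \<noteq> T \<longrightarrow>
              finite_intersection_property \<Lambda> D (S_map \<Lambda> D ` A))
        \<longleftrightarrow> (\<forall>A. ideal A (subring_of_prod \<Lambda> D T) \<and> A \<noteq> T \<longrightarrow>
              (\<exists>U. BA_ultrafilter \<Lambda> D U \<and>
                   ideal (ultra_ideal \<Lambda> D T U) (subring_of_prod \<Lambda> D T) \<and>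
                   A \<subseteq> ultra_ideal \<Lambda> D T U)))
     \<and> ((\<forall>A. ideal A (subring_of_prod \<Lambda> D T) \<and> A \<noteq> T \<longrightarrow>
              (\<exists>U. BA_ultrafilter \<Lambda> D U \<and>
                   ideal (ultra_ideal \<Lambda> D T U) (subring_of_prod \<Lambda> D T) \<and>
                   A \<subseteq> ultra_ideal \<Lambda> D T U))
        \<longleftrightarrow> (\<forall>A. maximalideal A (subring_of_prod \<Lambda> D T) \<longrightarrow>
              (\<exists>U. BA_ultrafilter \<Lambda> D U \<and> A = ultra_ideal \<Lambda> D T U)))"
proof -
  interpret subring_of_product \<Lambda> D T
    using assms by (rule subring_of_product.intro)
  let ?R = "subring_of_prod \<Lambda> D T"
  let ?b = "\<forall>A. ideal A ?R \<and> A \<noteq> T \<longrightarrow> finite_intersection_property \<Lambda> D (S_map \<Lambda> D ` A)"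
  let ?c = "\<forall>A. ideal A ?R \<and> A \<noteq> T \<longrightarrow>
    (\<exists>U. BA_ultrafilter \<Lambda> D U \<and> ideal (ultra_ideal \<Lambda> D T U) ?R \<and> A \<subseteq> ultra_ideal \<Lambda> D T U)"
  let ?d = "\<forall>A. maximalideal A ?R \<longrightarrow> (\<exists>U. BA_ultrafilter \<Lambda> D U \<and> A = ultra_ideal \<Lambda> D T U)"
  \<comment> \<open>The four implications form the cycle (a), (b), (c), (d), (a), from which the
    three equivalences follow propositionally.\<close>
  have "?b" if "skolem_property \<Lambda> D T"
    using skolem_imp_fip[OF that] by blast
  moreover have "?c" if ?b
  proof (intro allI impI)
    fix A assume A: "ideal A ?R \<and> A \<noteq> T"
    then have "A \<subseteq> T"
      using additive_subgroup.a_subset[OF ideal.axioms(1), of A ?R] by simp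
    then show "\<exists>U. BA_ultrafilter \<Lambda> D U \<and> ideal (ultra_ideal \<Lambda> D T U) ?R \<and>
        A \<subseteq> ultra_ideal \<Lambda> D T U"
      using fip_imp_ultra_ideal that A by blast
  qed
  moreover have "?d" if c: ?c
  proof (intro allI impI)
    fix A assume A: "maximalideal A ?R"
    then have "ideal A ?R" "A \<noteq> T"
      using maximalideal.axioms(1) maximalideal.I_notcarr[OF A] by auto
    then obtain U where "BA_ultrafilter \<Lambda> D U" "A \<subseteq> ultra_ideal \<Lambda> D T U"
      using c by blast
    then show "\<exists>U. BA_ultrafilter \<Lambda> D U \<and> A = ultra_ideal \<Lambda> D T U"
      using maximalideal_eq_ultra_ideal[OF A] by blast
  qed
  moreover have "skolem_property \<Lambda> D T" if ?d
    using maximalideals_ultra_imp_skolem that by blast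
  ultimately show ?thesis
    by argo
qed

end
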